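(* Let $n=2^k$ with $k\in\{0,1,2,\dots\}$, let $f:(0,\infty)\to\mathbb{C}$ be a measurable function and let $y>0$. Then $$\mathcal{L}_{2n}\{\mathcal{L}_n\{f(x);u\};y\}=\frac{1}{2ny^{2n}}\int_0^\infty x^{n-1}f(x)\,dx-\frac{\sqrt{\pi}}{4ny^{3n}}\int_0^\infty x^{n-1}\,\frac{1}{x^{3n}}\,f\!\Big(\frac1x\Big)\exp\!\Big(\frac{1}{4x^{2n}y^{2n}}\Big)\operatorname{erfc}\!\Big(\frac{1}{2x^ny^n}\Big)dx,$$ provided that each member of this identity exists. Here the outer transform on the left is applied to the function $u\mapsto\mathcal{L}_n\{f(x);u\}$ and evaluated at $y$.
   Context: For $n=2^k$, $k\in\{0,1,2,\dots\}$, a function $f$ on $(0,\infty)$ and $y>0$, define $$\mathcal{L}_n\{f(x);y\}=\int_0^\infty x^{n-1}\exp(-y^nx^n)f(x)\,dx,\qquad \mathcal{L}_{2n}\{f(x);y\}=\int_0^\infty x^{2n-1}\exp(-y^{2n}x^{2n})f(x)\,dx.$$ In the notation $\mathcal{T}\{f(x);y\}$, the variable $x$ is the dummy variable of the function being transformed and $y$ is the point at which the transform is evaluated. The complementary error function is $\operatorname{erfc}(s)=\frac{2}{\sqrt{\pi}}\int_s^\infty e^{-t^2}\,dt$. Existence of an integral is understood as absolute convergence (Lebesgue integrability). *)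

theory Defs
  imports "HOL-Analysis.Analysis"
begin

text \<open>
  The transform of index \<open>m\<close>; it covers both \<open>L_n\<close> (\<open>m = n\<close>) and \<open>L_2n\<close> (\<open>m = 2 * n\<close>).  It is
  meant for \<open>m \<ge> 1\<close>, where the truncated \<open>m - 1\<close> is the true difference.  A function on the open
  half-line is a total function whose values outside \<open>{0<..}\<close> play no role.  As the Bochner integral
  is 0 when the integrand is not integrable, existence is a separate predicate.
\<close>

definition L_integrand :: "nat \<Rightarrow> (real \<Rightarrow> complex) \<Rightarrow> real \<Rightarrow> real \<Rightarrow> complex" where
  "L_integrand m f y x = of_real (x ^ (m - 1) * exp (- (y ^ m * x ^ m))) * f x"

definition L_exists :: "nat \<Rightarrow> (real \<Rightarrow> complex) \<Rightarrow> real \<Rightarrow> bool" where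
  "L_exists m f y \<longleftrightarrow> set_integrable lebesgue {0<..} (L_integrand m f y)"

definition L_transform :: "nat \<Rightarrow> (real \<Rightarrow> complex) \<Rightarrow> real \<Rightarrow> complex" where
  "L_transform m f y = (LINT x:{0<..}|lebesgue. L_integrand m f y x)"

definition erfc :: "real \<Rightarrow> real" where
  "erfc s = 2 / sqrt pi * (LINT t:{s..}|lebesgue. exp (- (t\<^sup>2)))"

end

theory Submission imports Defs begin

text \<open>
  By Fubini the left-hand side is the integral of \<open>x ^ (n - 1) * f x\<close> against the kernel
  \<open>K x = \<integral> u ^ (2 * n - 1) * exp (- y ^ (2 * n) * u ^ (2 * n) - x ^ n * u ^ n) du\<close>. One integration by
  parts and completing the square give \<open>K x = c - d * G x\<close>, where \<open>c = 1 / (2 * n * y ^ (2 * n))\<close> and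
  \<open>d * G x\<close> is the nonnegative error-function term. So \<open>0 \<le> K x \<le> c\<close>, and integrability of
  \<open>x ^ (n - 1) * f x\<close> alone justifies Fubini. The inversion \<open>x \<mapsto> 1 / x\<close> brings the error-function
  term into the stated form.
\<close>

text \<open>Fubini is applied to the product of two copies of the completed measure
  \<open>lebesgue\<close>. Closed balls of integer radius have finite measure and exhaust the
  space.\<close>

lemma sigma_finite_lebesgue: "sigma_finite_measure (lebesgue :: 'a::euclidean_space measure)"
proof
  show "\<exists>A. countable A \<and> A \<subseteq> sets (lebesgue :: 'a measure) \<and> \<Union>A = space lebesgue \<and>
      (\<forall>a\<in>A. emeasure lebesgue a \<noteq> \<infinity>)"
  proof (intro exI conjI ballI)
    show "\<Union>(range (\<lambda>i. cball (0::'a) (real i))) = space lebesgue"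
      by (auto simp: real_arch_simple)
    fix a :: "'a set" assume "a \<in> range (\<lambda>i. cball 0 (real i))"
    then obtain r where "a = cball 0 r" by auto
    then show "emeasure lebesgue a \<noteq> \<infinity>"
      using emeasure_lborel_cball_finite[of "0::'a" r] by simp
  qed auto
qed

section \<open>Closed form of the kernel\<close>

text \<open>The combination \<open>u ^ (2 * n - 1) + b / (2 * a\<^sup>2) * u ^ (n - 1)\<close>,
  multiplied by \<open>E\<close>, is the exact derivative of
  \<open>- E / (2 * n * a\<^sup>2)\<close>; this is the integration by parts in disguise. Both
  summands are nonnegative on the half-line, so integrability of the sum passes to each of
  them.\<close>

lemma tail_integrals:
  fixes a b :: real and n :: nat
  assumes a: "a > 0" and b: "b > 0" and n: "n > 0"
  defines "E \<equiv> \<lambda>u. exp (- (a\<^sup>2 * u ^ (2 * n) + b * u ^ n))"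
  shows "set_integrable lebesgue {0<..} (\<lambda>u. u ^ (2 * n - 1) * E u)" (is "?I1")
    and "set_integrable lebesgue {0<..} (\<lambda>u. u ^ (n - 1) * E u)" (is "?I2")
    and "(LINT u:{0<..}|lebesgue. u ^ (2 * n - 1) * E u)
         + b / (2 * a\<^sup>2) * (LINT u:{0<..}|lebesgue. u ^ (n - 1) * E u) = 1 / (2 * real n * a\<^sup>2)"
proof -
  let ?f = "\<lambda>u. (u ^ (2 * n - 1) + b / (2 * a\<^sup>2) * u ^ (n - 1)) * E u"
  let ?F = "\<lambda>u. - (1 / (2 * real n * a\<^sup>2)) * E u"
  have E_meas [measurable]: "E \<in> borel_measurable borel"
    unfolding E_def by measurable
  have E0: "0 < E u" for u by (simp add: E_def)
  have pos: "0 \<le> ?f u" if "0 \<le> u" for u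
    using that b E0[of u] by simp
  have "(E \<longlongrightarrow> 0) at_top"
    unfolding E_def using n a b
    by (intro filterlim_compose[OF exp_at_bot] filterlim_compose[OF filterlim_uminus_at_bot_at_top]
        filterlim_at_top_add_at_top filterlim_tendsto_pos_mult_at_top[OF tendsto_const]
        filterlim_pow_at_top filterlim_ident) auto
  then have lim: "(?F \<longlongrightarrow> - (1 / (2 * real n * a\<^sup>2)) * 0) at_top"
    by (intro tendsto_intros)
  have deriv: "DERIV ?F u :> ?f u" for u
    unfolding E_def using n a b
    by (auto intro!: derivative_eq_intros simp: field_simps power2_eq_square)
  \<comment> \<open>\<open>n > 0\<close> makes both powers of 0 vanish, hence
    \<open>E 0 = 1\<close>.\<close>
  have F0: "?F 0 = - (1 / (2 * real n * a\<^sup>2))"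
    using n by (simp add: E_def power_0_left)
  \<comment> \<open>For a nonnegative integrand the fundamental theorem yields the value
    \<open>0 - ?F 0\<close> without prior integrability. It speaks of the closed half-line; the
    point 0 is then removed as a null set.\<close>
  have "(\<integral>\<^sup>+u. ennreal (?f u) * indicator {0..} u \<partial>lborel) = ennreal (1 / (2 * real n * a\<^sup>2))"
    using nn_integral_FTC_atLeast[of ?f 0 ?F, OF _ deriv pos lim] unfolding F0 by simp
  moreover have "(\<integral>\<^sup>+u. ennreal (?f u) * indicator {0..} u \<partial>lborel)
      = (\<integral>\<^sup>+u. ennreal (indicator {0<..} u * ?f u) \<partial>lborel)"
    using AE_lborel_singleton[of "0::real"]
    by (intro nn_integral_cong_AE, elim eventually_mono) (auto simp: indicator_def)
  moreover have "0 \<le> indicator {0<..} u * ?f u" for u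
    using pos[of u] by (cases "0 < u") auto
  then have "AE u in lborel. 0 \<le> indicator {0<..} u * ?f u"
    by (intro AE_I2)
  ultimately have "has_bochner_integral lborel (\<lambda>u. indicator {0<..} u * ?f u) (1 / (2 * real n * a\<^sup>2))"
    using a n by (intro has_bochner_integral_nn_integral) simp_all
  \<comment> \<open>The integral is computed for \<open>lborel\<close> and carried over to its
    completion \<open>lebesgue\<close>.\<close>
  then have int: "set_integrable lebesgue {0<..} ?f"
    and val: "(LINT u:{0<..}|lebesgue. ?f u) = 1 / (2 * real n * a\<^sup>2)"
    by (auto simp: set_integrable_def set_lebesgue_integral_def integrable_completion
        integral_completion has_bochner_integral_iff)
  have meas: "g \<in> borel_measurable borel \<Longrightarrow> set_borel_measurable lebesgue {0<..} g"
    for g :: "real \<Rightarrow> real"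
    unfolding set_borel_measurable_def
    by (intro measurable_completion) (auto intro!: borel_measurable_scaleR)
  have bound: "norm (u ^ (2 * n - 1) * E u) \<le> norm (?f u)"
    "norm (b / (2 * a\<^sup>2) * (u ^ (n - 1) * E u)) \<le> norm (?f u)" if "0 < u" for u
  proof -
    have "0 \<le> u ^ (2 * n - 1) * E u" "0 \<le> b / (2 * a\<^sup>2) * (u ^ (n - 1) * E u)"
      using that b E0[of u] by simp_all
    moreover have "?f u = u ^ (2 * n - 1) * E u + b / (2 * a\<^sup>2) * (u ^ (n - 1) * E u)"
      by (simp add: algebra_simps)
    ultimately show "norm (u ^ (2 * n - 1) * E u) \<le> norm (?f u)"
      "norm (b / (2 * a\<^sup>2) * (u ^ (n - 1) * E u)) \<le> norm (?f u)"
      unfolding real_norm_def by linarith+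
  qed
  show 1: ?I1
    by (rule set_integrable_bound[OF int meas]) (use bound(1) in \<open>auto intro!: AE_I2\<close>)
  have "set_integrable lebesgue {0<..} (\<lambda>u. b / (2 * a\<^sup>2) * (u ^ (n - 1) * E u))"
    by (rule set_integrable_bound[OF int meas]) (use bound(2) in \<open>auto intro!: AE_I2\<close>)
  then show 2: ?I2
    using a b by (subst (asm) set_integrable_mult_right_iff) auto
  show "(LINT u:{0<..}|lebesgue. u ^ (2 * n - 1) * E u)
         + b / (2 * a\<^sup>2) * (LINT u:{0<..}|lebesgue. u ^ (n - 1) * E u) = 1 / (2 * real n * a\<^sup>2)"
    using set_integral_add(2)[OF 1 set_integrable_mult_right[OF 2, of "b / (2 * a\<^sup>2)"]] val
    by (simp add: algebra_simps)
qed

text \<open>The substitution \<open>t = a * u ^ n + b / (2 * a)\<close> completes the square in the exponent.\<close>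
lemma gauss_tail:
  fixes a b :: real and n :: nat
  assumes a: "a > 0" and b: "b > 0" and n: "n > 0"
  shows "(LINT u:{0<..}|lebesgue. u ^ (n - 1) * exp (- (a\<^sup>2 * u ^ (2 * n) + b * u ^ n)))
    = sqrt pi / (2 * real n * a) * exp (b\<^sup>2 / (4 * a\<^sup>2)) * erfc (b / (2 * a))"
proof -
  let ?g = "\<lambda>u. a * u ^ n + b / (2 * a)" and ?s = "b / (2 * a)"
  \<comment> \<open>The exponential in \<open>?c\<close> compensates the constant left over by
    completing the square; \<open>1 / (n * a)\<close> cancels the constant in the derivative of
    \<open>?g\<close>.\<close>
  let ?c = "exp (b\<^sup>2 / (4 * a\<^sup>2)) / (n * a)"
  let ?h = "\<lambda>t. ?c * exp (- t\<^sup>2)"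
  have g: "(?g has_real_derivative a * n * u ^ (n - 1)) (at u within {0<..})" for u
    by (auto intro!: derivative_eq_intros)
  have inj: "inj_on ?g {0<..}"
    using a n by (auto simp: inj_on_def power_eq_iff_eq_base)
  have im: "?g ` {0<..} = {?s<..}"
  proof (intro equalityI subsetI)
    fix t assume "t \<in> {?s<..}"
    then have t: "t - ?s > 0" by simp
    then show "t \<in> ?g ` {0<..}"
      \<comment> \<open>The witness is the inverse of \<open>?g\<close> at \<open>t\<close>.\<close>
      using n a by (intro image_eqI[of _ _ "root n ((t - ?s) / a)"]) (auto simp: real_root_pow_pos)
  qed (use a in auto)
  have eq: "\<bar>a * n * u ^ (n - 1)\<bar> *\<^sub>R ?h (?g u)
      = u ^ (n - 1) * exp (- (a\<^sup>2 * u ^ (2 * n) + b * u ^ n))" if "u \<in> {0<..}" for u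
  proof -
    have "b\<^sup>2 / (4 * a\<^sup>2) + - (?g u)\<^sup>2 = - (a\<^sup>2 * u ^ (2 * n) + b * u ^ n)"
      using a by (simp add: field_simps power2_eq_square power_mult power_mult_distrib)
    then have "exp (b\<^sup>2 / (4 * a\<^sup>2)) * exp (- (?g u)\<^sup>2) = exp (- (a\<^sup>2 * u ^ (2 * n) + b * u ^ n))"
      by (simp add: exp_add[symmetric])
    then show ?thesis using that a n by (simp add: abs_mult)
  qed
  \<comment> \<open>Integrability is known on the \<open>u\<close> side; the change of variables
    transfers it, together with the value, to the Gaussian in \<open>t\<close>.\<close>
  have int: "(\<lambda>u. \<bar>a * n * u ^ (n - 1)\<bar> *\<^sub>R ?h (?g u)) absolutely_integrable_on {0<..}"
    by (rule iffD2[OF set_integrable_cong[OF refl refl eq] tail_integrals(2)[OF a b n]])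
  have S: "{0<..} \<in> sets (lebesgue :: real measure)" by simp
  have h: "?h absolutely_integrable_on {?s<..} \<and> integral {?s<..} ?h
      = integral {0<..} (\<lambda>u. \<bar>a * n * u ^ (n - 1)\<bar> *\<^sub>R ?h (?g u))"
    using iffD1[OF has_absolute_integral_change_of_variables_real[OF S g inj, of ?h]] int
    unfolding im by blast
  have "(LINT t:{?s<..}|lebesgue. ?h t)
      = (LINT u:{0<..}|lebesgue. \<bar>a * n * u ^ (n - 1)\<bar> *\<^sub>R ?h (?g u))"
    by (simp only: set_lebesgue_integral_eq_integral(2)[OF conjunct1[OF h]]
        set_lebesgue_integral_eq_integral(2)[OF int] conjunct2[OF h])
  also have "\<dots> = (LINT u:{0<..}|lebesgue. u ^ (n - 1) * exp (- (a\<^sup>2 * u ^ (2 * n) + b * u ^ n)))"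
    using eq by (intro set_lebesgue_integral_cong) auto
  finally have "(LINT u:{0<..}|lebesgue. u ^ (n - 1) * exp (- (a\<^sup>2 * u ^ (2 * n) + b * u ^ n)))
      = ?c * (LINT t:{?s<..}|lebesgue. exp (- t\<^sup>2))" by simp
  \<comment> \<open>The image of \<open>?g\<close> is an open half-line, whereas \<open>erfc\<close>
    integrates over the closed one.\<close>
  also have "(LINT t:{?s<..}|lebesgue. exp (- t\<^sup>2)) = (LINT t:{?s..}|lebesgue. exp (- t\<^sup>2))"
  proof (rule set_integral_cong_set)
    show "AE t in lebesgue. (t \<in> {?s..}) = (t \<in> {?s<..})"
      using AE_completion[OF AE_lborel_singleton[of ?s]] by eventually_elim auto
  qed (auto simp: set_borel_measurable_def intro!: measurable_completion borel_measurable_scaleR)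
  finally show ?thesis using a n by (simp add: erfc_def field_simps)
qed

text \<open>Take \<open>a = y ^ n\<close> and \<open>b = x ^ n\<close>, solve the identity of
  \<open>tail_integrals\<close> for its first integral and insert \<open>gauss_tail\<close> for the
  second. The power \<open>y ^ (3 * n)\<close> arises as \<open>a\<close> times the square of
  \<open>a\<close>.\<close>

lemma kernel_value:
  fixes x y :: real and n :: nat
  assumes x: "x > 0" and y: "y > 0" and n: "n > 0"
  shows "set_integrable lebesgue {0<..} (\<lambda>u. u ^ (2 * n - 1) * exp (- (y ^ (2 * n) * u ^ (2 * n) + x ^ n * u ^ n)))"
    and "(LINT u:{0<..}|lebesgue. u ^ (2 * n - 1) * exp (- (y ^ (2 * n) * u ^ (2 * n) + x ^ n * u ^ n)))
     = 1 / (2 * real n * y ^ (2 * n))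
       - sqrt pi / (4 * real n * y ^ (3 * n)) * (x ^ n * exp (x ^ (2 * n) / (4 * y ^ (2 * n))) * erfc (x ^ n / (2 * y ^ n)))"
proof -
  have a: "y ^ n > 0" and b: "x ^ n > 0" using x y by auto
  have sq: "(z ^ n)\<^sup>2 = z ^ (2 * n)" and cb: "z ^ n * (z ^ n)\<^sup>2 = z ^ (3 * n)" for z :: real
    by (simp_all add: mult.commute flip: power_mult power_add)
  note T = tail_integrals[OF a b n] gauss_tail[OF a b n]
  show "set_integrable lebesgue {0<..} (\<lambda>u. u ^ (2 * n - 1) * exp (- (y ^ (2 * n) * u ^ (2 * n) + x ^ n * u ^ n)))"
    using T(1) unfolding sq .
  have "x ^ n / (2 * (y ^ n)\<^sup>2) * (sqrt pi / (2 * real n * y ^ n) * exp ((x ^ n)\<^sup>2 / (4 * (y ^ n)\<^sup>2)) * erfc (x ^ n / (2 * y ^ n)))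
    = sqrt pi / (4 * real n * y ^ (3 * n)) * (x ^ n * exp (x ^ (2 * n) / (4 * y ^ (2 * n))) * erfc (x ^ n / (2 * y ^ n)))"
    unfolding cb[symmetric] sq[symmetric] by (simp add: mult_ac)
  then show "(LINT u:{0<..}|lebesgue. u ^ (2 * n - 1) * exp (- (y ^ (2 * n) * u ^ (2 * n) + x ^ n * u ^ n)))
     = 1 / (2 * real n * y ^ (2 * n))
       - sqrt pi / (4 * real n * y ^ (3 * n)) * (x ^ n * exp (x ^ (2 * n) / (4 * y ^ (2 * n))) * erfc (x ^ n / (2 * y ^ n)))"
    using T(3) unfolding T(4) unfolding sq by linarith
qed

section \<open>Inversion of the half-line and the sign of \<open>erfc\<close>\<close>

text \<open>The map \<open>x \<mapsto> 1 / x\<close> is an involution of the open half-line, and the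
  absolute value of its derivative is the weight on the left.\<close>

lemma integral_inversion:
  fixes h :: "real \<Rightarrow> complex"
  assumes "set_integrable lebesgue {0<..} h"
  shows "(LINT x:{0<..}|lebesgue. of_real (1 / x\<^sup>2) * h (1 / x)) = (LINT x:{0<..}|lebesgue. h x)"
proof -
  have g: "((\<lambda>x. 1 / x) has_real_derivative - (1 / x\<^sup>2)) (at x within {0<..})" if "x \<in> {0<..}" for x :: real
    using that by (auto intro!: derivative_eq_intros simp: power2_eq_square)
  have inj: "inj_on (\<lambda>x::real. 1 / x) {0<..}" by (auto simp: inj_on_def)
  have "\<exists>z>0. x = 1 / z" if "x > 0" for x :: real
    using that by (intro exI[of _ "1 / x"]) auto
  then have im: "(\<lambda>x::real. 1 / x) ` {0<..} = {0<..}" by auto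
  let ?k = "\<lambda>x. \<bar>- (1 / x\<^sup>2)\<bar> *\<^sub>R h (1 / x)"
  have "?k absolutely_integrable_on {0<..} \<and> integral {0<..} ?k = integral {0<..} h"
    using has_absolute_integral_change_of_variables_real[OF _ g inj, of h "integral {0<..} h"] assms
    unfolding im by auto
  then show ?thesis
    using assms by (simp add: set_lebesgue_integral_eq_integral scaleR_conv_of_real)
qed

text \<open>This sign is what bounds the kernel above by its constant term.\<close>

lemma erfc_nonneg: "0 \<le> erfc s"
  unfolding erfc_def set_lebesgue_integral_def
  by (intro mult_nonneg_nonneg integral_nonneg) auto

section \<open>Exchange of the integrals and assembly of the identity\<close>

theorem lemma2:
  fixes k n :: nat and f :: "real \<Rightarrow> complex" and y :: real
  assumes "n = 2 ^ k"
    and "f \<in> borel_measurable (lebesgue_on {0<..})"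
    and "y > 0"
    and "\<forall>u>0. L_exists n f u"
    and "L_exists (2 * n) (\<lambda>u. L_transform n f u) y"
    and "set_integrable lebesgue {0<..} (\<lambda>x. of_real (x ^ (n - 1)) * f x)"
    and "set_integrable lebesgue {0<..}
           (\<lambda>x. of_real (x ^ (n - 1)) * of_real (1 / x ^ (3 * n)) * f (1 / x)
              * of_real (exp (1 / (4 * x ^ (2 * n) * y ^ (2 * n))))
              * of_real (erfc (1 / (2 * x ^ n * y ^ n))))"
  shows "L_transform (2 * n) (\<lambda>u. L_transform n f u) y =
      of_real (1 / (2 * real n * y ^ (2 * n)))
        * (LINT x:{0<..}|lebesgue. of_real (x ^ (n - 1)) * f x)
    - of_real (sqrt pi / (4 * real n * y ^ (3 * n)))
        * (LINT x:{0<..}|lebesgue.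
             of_real (x ^ (n - 1)) * of_real (1 / x ^ (3 * n)) * f (1 / x)
              * of_real (exp (1 / (4 * x ^ (2 * n) * y ^ (2 * n))))
              * of_real (erfc (1 / (2 * x ^ n * y ^ n))))"
proof -
  have n: "n > 0" and y: "y > 0" using assms by auto
  define c d where "c = 1 / (2 * real n * y ^ (2 * n))" and "d = sqrt pi / (4 * real n * y ^ (3 * n))"
  have d: "d > 0" using n y by (simp add: d_def)
  \<comment> \<open>\<open>G\<close> is the error-function term before inversion; the integrand of
    the statement comes from \<open>G (1 / x)\<close>.\<close>
  define G where "G = (\<lambda>x. x ^ n * exp (x ^ (2 * n) / (4 * y ^ (2 * n))) * erfc (x ^ n / (2 * y ^ n)))"
  define \<phi> where "\<phi> = (\<lambda>x. of_real (x ^ (n - 1)) * f x)"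
  define H where "H = (\<lambda>x u. u ^ (2 * n - 1) * exp (- (y ^ (2 * n) * u ^ (2 * n) + x ^ n * u ^ n)))"
  \<comment> \<open>Both indicators are built into \<open>P\<close>, so that Fubini runs over the
    whole plane and \<open>P\<close> vanishes off the open quadrant.\<close>
  define P where "P = (\<lambda>x u. (indicator {0<..} x *\<^sub>R \<phi> x) * complex_of_real (indicator {0<..} u * H x u))"
  interpret L: sigma_finite_measure "lebesgue :: real measure" by (rule sigma_finite_lebesgue)
  interpret L2: pair_sigma_finite "lebesgue :: real measure" "lebesgue :: real measure" ..
  have G_nonneg: "0 \<le> G x" if "x > 0" for x
    using that erfc_nonneg by (simp add: G_def)
  have H_int: "integrable lebesgue (\<lambda>u. indicator {0<..} u * H x u)"
    and H_val: "(\<integral>u. indicator {0<..} u * H x u \<partial>lebesgue) = c - d * G x" if "x > 0" for x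
    using kernel_value[OF that y n]
    by (simp_all add: set_integrable_def set_lebesgue_integral_def H_def c_def d_def G_def)
  have \<phi>_int: "integrable lebesgue (\<lambda>x. indicator {0<..} x *\<^sub>R \<phi> x)"
    using assms(6) by (simp add: set_integrable_def \<phi>_def)
  have id_meas: "(\<lambda>x::real. x) \<in> borel_measurable lebesgue"
    by (intro measurable_completion) simp
  \<comment> \<open>The function \<open>f\<close> is only Lebesgue measurable, so joint
    measurability is obtained by composing the integrable function of \<open>x\<close> with the
    projection \<open>fst\<close>; the remaining factor is built from the measurable
    projections.\<close>
  have "(\<lambda>p. indicator {0<..} (fst p) *\<^sub>R \<phi> (fst p)) \<in> borel_measurable (lebesgue \<Otimes>\<^sub>M lebesgue :: (real \<times> real) measure)"
    using measurable_compose[OF measurable_fst borel_measurable_integrable[OF \<phi>_int]] .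
  moreover have [measurable]: "fst \<in> borel_measurable (lebesgue \<Otimes>\<^sub>M lebesgue :: (real \<times> real) measure)"
     "snd \<in> borel_measurable (lebesgue \<Otimes>\<^sub>M lebesgue :: (real \<times> real) measure)"
    using measurable_compose[OF measurable_fst id_meas] measurable_compose[OF measurable_snd id_meas]
    by auto
  ultimately have P_meas: "(\<lambda>p. P (fst p) (snd p)) \<in> borel_measurable (lebesgue \<Otimes>\<^sub>M lebesgue)"
    unfolding P_def H_def by measurable
  have P_int_u: "integrable lebesgue (P x)" for x
    unfolding P_def using H_int[of x]
    by (cases "x > 0") (auto simp del: of_real_mult)
  \<comment> \<open>\<open>H\<close> is nonnegative for \<open>u > 0\<close>, so the norm affects
    only the factor in \<open>x\<close> and the kernel value reappears.\<close>
  have norm_P: "(\<integral>u. norm (P x u) \<partial>lebesgue) = norm (indicator {0<..} x *\<^sub>R \<phi> x) * (c - d * G x)" for x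
  proof (cases "x > 0")
    case True
    have "norm (P x u) = norm (indicator {0<..} x *\<^sub>R \<phi> x) * (indicator {0<..} u * H x u)" for u
      by (auto simp: P_def norm_mult norm_power H_def indicator_def)
    then show ?thesis using H_val[OF True] by simp
  qed (simp add: P_def)
  have "integrable lebesgue (\<lambda>x. \<integral>u. norm (P x u) \<partial>lebesgue)"
  proof (rule Bochner_Integration.integrable_bound)
    show "integrable lebesgue (\<lambda>x. norm (indicator {0<..} x *\<^sub>R \<phi> x) * c)"
      using \<phi>_int by (intro integrable_mult_left integrable_norm)
    show "(\<lambda>x. \<integral>u. norm (P x u) \<partial>lebesgue) \<in> borel_measurable lebesgue"
      using P_meas by (intro L.borel_measurable_lebesgue_integral) (simp add: case_prod_beta)
    have "norm (\<integral>u. norm (P x u) \<partial>lebesgue)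
        \<le> norm (norm (indicator {0<..} x *\<^sub>R \<phi> x) * c)" for x
    proof -
      have "norm (\<integral>u. norm (P x u) \<partial>lebesgue) = (\<integral>u. norm (P x u) \<partial>lebesgue)" by simp
      also have "\<dots> \<le> norm (indicator {0<..} x *\<^sub>R \<phi> x) * c"
        unfolding norm_P using G_nonneg[of x] d by (cases "x > 0") (auto intro!: mult_left_mono)
      also have "\<dots> \<le> norm (norm (indicator {0<..} x *\<^sub>R \<phi> x) * c)"
        unfolding real_norm_def by (rule abs_ge_self)
      finally show ?thesis .
    qed
    then show "AE x in lebesgue. norm (\<integral>u. norm (P x u) \<partial>lebesgue)
        \<le> norm (norm (indicator {0<..} x *\<^sub>R \<phi> x) * c)"
      by (rule AE_I2)
  qed
  then have P_int: "integrable (lebesgue \<Otimes>\<^sub>M lebesgue) (case_prod P)"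
    using P_meas P_int_u by (intro L2.Fubini_integrable) (auto simp: case_prod_beta)
  have P_u: "(\<integral>u. P x u \<partial>lebesgue) = indicator {0<..} x *\<^sub>R (\<phi> x * of_real (c - d * G x))" for x
    unfolding P_def using H_val[of x] by (cases "x > 0") (simp_all del: of_real_mult)
  have "integrable lebesgue (\<lambda>x. \<integral>u. P x u \<partial>lebesgue)"
    using L2.integrable_fst'[OF P_int] by simp
  then have PK_int: "set_integrable lebesgue {0<..} (\<lambda>x. \<phi> x * of_real (c - d * G x))"
    unfolding P_u set_integrable_def .
  have \<phi>_set: "set_integrable lebesgue {0<..} \<phi>"
    using \<phi>_int by (simp add: set_integrable_def)
  \<comment> \<open>Integrability of the \<open>G\<close> term is recovered by solving the kernel
    formula for it, which uses \<open>d \<noteq> 0\<close>. It allows the integral to be split and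
    inverted below.\<close>
  have "set_integrable lebesgue {0<..} (\<lambda>x. inverse (of_real d) * (of_real c * \<phi> x - \<phi> x * of_real (c - d * G x)))"
    by (intro set_integrable_mult_right set_integral_diff PK_int \<phi>_set)
  also have "(\<lambda>x. inverse (of_real d) * (of_real c * \<phi> x - \<phi> x * of_real (c - d * G x))) = (\<lambda>x. \<phi> x * of_real (G x))"
    using d by (auto simp: field_simps)
  finally have G_int: "set_integrable lebesgue {0<..} (\<lambda>x. \<phi> x * of_real (G x))" .

  have "L_transform (2 * n) (\<lambda>u. L_transform n f u) y = (\<integral>u. (\<integral>x. P x u \<partial>lebesgue) \<partial>lebesgue)"
    unfolding L_transform_def L_integrand_def set_lebesgue_integral_def
  proof (intro Bochner_Integration.integral_cong refl)
    fix u :: real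
    let ?w = "complex_of_real (u ^ (2 * n - 1) * exp (- (y ^ (2 * n) * u ^ (2 * n))))"
    \<comment> \<open>The outer factor does not depend on \<open>x\<close>, so it moves inside the
      inner integral, where the two exponentials merge into the one in \<open>H\<close>.\<close>
    have "indicator {0<..} u *\<^sub>R (?w * (\<integral>x. indicator {0<..} x *\<^sub>R
        (of_real (x ^ (n - 1) * exp (- (u ^ n * x ^ n))) * f x) \<partial>lebesgue))
      = (\<integral>x. indicator {0<..} u *\<^sub>R (?w * (indicator {0<..} x *\<^sub>R
        (of_real (x ^ (n - 1) * exp (- (u ^ n * x ^ n))) * f x))) \<partial>lebesgue)"
      by (simp only: integral_mult_right_zero integral_scaleR_right)
    also have "\<dots> = (\<integral>x. P x u \<partial>lebesgue)"
      by (intro Bochner_Integration.integral_cong refl)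
        (simp add: P_def H_def \<phi>_def scaleR_conv_of_real exp_diff exp_minus field_simps exp_add)
    finally show "indicator {0<..} u *\<^sub>R (?w * (\<integral>x. indicator {0<..} x *\<^sub>R
        (of_real (x ^ (n - 1) * exp (- (u ^ n * x ^ n))) * f x) \<partial>lebesgue)) = (\<integral>x. P x u \<partial>lebesgue)" .
  qed
  also have "\<dots> = (\<integral>x. (\<integral>u. P x u \<partial>lebesgue) \<partial>lebesgue)"
    by (rule L2.Fubini_integral[OF P_int])
  also have "\<dots> = (LINT x:{0<..}|lebesgue. of_real c * \<phi> x - of_real d * (\<phi> x * of_real (G x)))"
    unfolding P_u set_lebesgue_integral_def by (simp add: algebra_simps)
  also have "\<dots> = of_real c * (LINT x:{0<..}|lebesgue. \<phi> x)
      - of_real d * (LINT x:{0<..}|lebesgue. \<phi> x * of_real (G x))"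
    using \<phi>_set G_int by (subst set_integral_diff) (auto intro: set_integrable_mult_right)
  also have "(LINT x:{0<..}|lebesgue. \<phi> x * of_real (G x))
      = (LINT x:{0<..}|lebesgue. of_real (1 / x\<^sup>2) * (\<phi> (1 / x) * of_real (G (1 / x))))"
    by (rule integral_inversion[OF G_int, symmetric])
  also have "\<dots> = (LINT x:{0<..}|lebesgue.
             of_real (x ^ (n - 1)) * of_real (1 / x ^ (3 * n)) * f (1 / x)
              * of_real (exp (1 / (4 * x ^ (2 * n) * y ^ (2 * n))))
              * of_real (erfc (1 / (2 * x ^ n * y ^ n))))"
  proof (intro set_lebesgue_integral_cong ballI allI impI)
    fix x :: real assume "x \<in> {0<..}"
    then have x: "x > 0" by simp
    \<comment> \<open>The 2 comes from the weight of the inversion, one \<open>n - 1\<close> from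
      \<open>\<phi> (1 / x)\<close>, the last \<open>n\<close> from \<open>G (1 / x)\<close>; the
      other \<open>n - 1\<close> offsets the factor \<open>x ^ (n - 1)\<close> kept in the target.
      As subtraction is truncated, \<open>n > 0\<close> matters here.\<close>
    have "3 * n = 2 + (n - 1) + (n - 1) + n"
      using n by simp
    then have "x ^ (3 * n) = x\<^sup>2 * x ^ (n - 1) * x ^ (n - 1) * x ^ n"
      by (simp only: power_add)
    then have "1 / x\<^sup>2 * (1 / x) ^ (n - 1) * (1 / x) ^ n = x ^ (n - 1) * (1 / x ^ (3 * n))"
      using x by (simp add: field_simps)
    then have pow: "complex_of_real (1 / x\<^sup>2) * of_real ((1 / x) ^ (n - 1)) * of_real ((1 / x) ^ n)
        = of_real (x ^ (n - 1)) * of_real (1 / x ^ (3 * n))"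
      unfolding of_real_mult[symmetric] by (rule arg_cong)
    have G_inv: "G (1 / x) = (1 / x) ^ n * (exp (1 / (4 * x ^ (2 * n) * y ^ (2 * n))) * erfc (1 / (2 * x ^ n * y ^ n)))"
      by (simp add: G_def power_one_over field_simps)
    have "of_real (1 / x\<^sup>2) * (\<phi> (1 / x) * of_real (G (1 / x)))
      = (of_real (1 / x\<^sup>2) * of_real ((1 / x) ^ (n - 1)) * of_real ((1 / x) ^ n)) * f (1 / x)
              * of_real (exp (1 / (4 * x ^ (2 * n) * y ^ (2 * n))))
              * of_real (erfc (1 / (2 * x ^ n * y ^ n)))"
      by (simp only: \<phi>_def G_inv of_real_mult mult_ac)
    then show "of_real (1 / x\<^sup>2) * (\<phi> (1 / x) * of_real (G (1 / x)))
      = of_real (x ^ (n - 1)) * of_real (1 / x ^ (3 * n)) * f (1 / x)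
              * of_real (exp (1 / (4 * x ^ (2 * n) * y ^ (2 * n))))
              * of_real (erfc (1 / (2 * x ^ n * y ^ n)))"
      unfolding pow .
  qed auto
  finally show ?thesis unfolding c_def d_def \<phi>_def .
qed

end
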